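(* For a function $f:\mathbb{R}\to\mathbb{R}$, the following are equivalent: (1) $f$ is $\tau_{\mathbb{Q}}$-continuous. (2) For every $x<y$, the restriction $f|_{L(x,y)}$ is continuous in the usual subspace topology. (3) For every $x<y$, the restriction $f|_{S(x,y)}$ is continuous in the usual subspace topology.
   Context: The topology $\tau_{\mathbb{Q}}$ on $\mathbb{R}$: a set $U\subseteq\mathbb{R}$ is $\tau_{\mathbb{Q}}$-open iff for every $a\in U$ and every real $x\neq0$ there is $\varepsilon(a,x)>0$ such that $a+qx\in U$ for all $q\in\mathbb{Q}$ with $0<q<\varepsilon(a,x)$. A function $f:\mathbb{R}\to\mathbb{R}$ is $\tau_{\mathbb{Q}}$-continuous if it is continuous as a map from $(\mathbb{R},\tau_{\mathbb{Q}})$ to $\mathbb{R}$ with the usual topology. For real $x\neq y$: $L(x,y)=\{qx+(1-q)y:q\in\mathbb{Q}\}$ and $S(x,y)=\{qx+(1-q)y: q\in\mathbb{Q}\cap[0,1]\}$, equipped with the subspace topology inherited from the usual topology of $\mathbb{R}$. *)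

theory Defs
  imports "HOL-Analysis.Analysis"
begin

definition tauQ_open :: "real set \<Rightarrow> bool" where
  "tauQ_open U \<longleftrightarrow>
     (\<forall>a\<in>U. \<forall>x::real. x \<noteq> 0 \<longrightarrow>
        (\<exists>\<epsilon>::real. \<epsilon> > 0 \<and> (\<forall>q\<in>\<rat>. 0 < q \<and> q < \<epsilon> \<longrightarrow> a + q * x \<in> U)))"

lemma istopology_tauQ_open: "istopology tauQ_open"
  unfolding istopology_def
proof (intro conjI allI impI)
  fix S T
  assume S: "tauQ_open S" and T: "tauQ_open T"
  show "tauQ_open (S \<inter> T)"
    unfolding tauQ_open_def
  proof (intro ballI allI impI)
    fix a x :: real
    assume a: "a \<in> S \<inter> T" and x: "x \<noteq> 0"
    obtain d where d: "d > 0" "\<forall>q\<in>\<rat>. 0 < q \<and> q < d \<longrightarrow> a + q * x \<in> S"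
      using S a x unfolding tauQ_open_def by blast
    obtain e where e: "e > 0" "\<forall>q\<in>\<rat>. 0 < q \<and> q < e \<longrightarrow> a + q * x \<in> T"
      using T a x unfolding tauQ_open_def by blast
    show "\<exists>\<epsilon>::real. \<epsilon> > 0 \<and> (\<forall>q\<in>\<rat>. 0 < q \<and> q < \<epsilon> \<longrightarrow> a + q * x \<in> S \<inter> T)"
      using d e by (intro exI[of _ "min d e"]) auto
  qed
next
  fix K
  assume K: "\<forall>S\<in>K. tauQ_open S"
  show "tauQ_open (\<Union>K)"
    unfolding tauQ_open_def
  proof (intro ballI allI impI)
    fix a x :: real
    assume "a \<in> \<Union>K" and x: "x \<noteq> 0"
    then obtain S where S: "S \<in> K" "a \<in> S" by blast
    then obtain e where "e > 0" "\<forall>q\<in>\<rat>. 0 < q \<and> q < e \<longrightarrow> a + q * x \<in> S"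
      using K x unfolding tauQ_open_def by blast
    with S show "\<exists>\<epsilon>::real. \<epsilon> > 0 \<and> (\<forall>q\<in>\<rat>. 0 < q \<and> q < \<epsilon> \<longrightarrow> a + q * x \<in> \<Union>K)"
      by blast
  qed
qed

definition tauQ :: "real topology" where
  "tauQ = topology tauQ_open"

lemma openin_tauQ [simp]: "openin tauQ U \<longleftrightarrow> tauQ_open U"
  by (simp add: tauQ_def topology_inverse' istopology_tauQ_open)

lemma topspace_tauQ [simp]: "topspace tauQ = UNIV"
proof -
  have "openin tauQ UNIV"
    by (auto simp: tauQ_open_def intro: exI[of _ 1])
  then show ?thesis
    using openin_subset by blast
qed

definition tauQ_continuous :: "(real \<Rightarrow> real) \<Rightarrow> bool" where
  "tauQ_continuous f \<longleftrightarrow> continuous_map tauQ euclidean f"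

definition rat_line :: "real \<Rightarrow> real \<Rightarrow> real set" where
  "rat_line x y = {q * x + (1 - q) * y | q. q \<in> \<rat>}"

definition rat_segment :: "real \<Rightarrow> real \<Rightarrow> real set" where
  "rat_segment x y = {q * x + (1 - q) * y | q. q \<in> \<rat> \<inter> {0..1}}"

end

theory Submission
  imports Defs
begin

text \<open>
  A \<open>tauQ\<close>-neighbourhood of \<open>a\<close> is seen only along the rational rays \<open>{a + q * d | q \<in> \<rat>, q > 0}\<close>,
  and how far along a ray it must reach depends on the ray. Continuity for \<open>tauQ\<close> is therefore a
  family of independent one-dimensional conditions: \<open>f (a + q * d)\<close> tends to \<open>f a\<close> as the rational
  number \<open>q\<close> decreases to \<open>0\<close>, for each base point \<open>a\<close> and each direction \<open>d \<noteq> 0\<close>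
  (\<open>tauQ_continuous_iff_radial_limits\<close>). This form of the condition compares directly with
  restrictions of \<open>f\<close>.

  Near any of its points \<open>a\<close>, the rational line through \<open>x\<close> and \<open>y\<close> consists of \<open>a\<close> and the two
  opposite rays in the directions \<open>x - y\<close> and \<open>y - x\<close>, so the two radial limits at \<open>a\<close> give
  continuity at \<open>a\<close> on the line. Rational segments are subsets of rational lines. Conversely, the
  ray from \<open>a\<close> in direction \<open>d\<close> starts inside the rational segment with end points \<open>a\<close> and \<open>a + d\<close>,
  so continuity at the end points of rational segments already gives all radial limits. These three
  steps close the circle of implications.
\<close>

text \<open>The filter of positive rational numbers decreasing to \<open>0\<close>; it turns the existence of a
  direction-dependent \<open>\<epsilon>\<close> into ``eventually''.\<close>

abbreviation rat_at_right_0 :: "real filter" where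
  "rat_at_right_0 \<equiv> at 0 within (\<rat> \<inter> {0<..})"

lemma eventually_rat_at_right_0:
  "eventually P rat_at_right_0 \<longleftrightarrow> (\<exists>\<epsilon>>0. \<forall>q\<in>\<rat>. 0 < q \<and> q < \<epsilon> \<longrightarrow> P q)"
  by (auto simp: eventually_at)

lemma tauQ_open_iff_eventually:
  "tauQ_open U \<longleftrightarrow> (\<forall>a\<in>U. \<forall>d. d \<noteq> 0 \<longrightarrow> (\<forall>\<^sub>F q in rat_at_right_0. a + q * d \<in> U))"
  by (simp add: tauQ_open_def eventually_rat_at_right_0)

text \<open>Both sides say that, for an open neighbourhood \<open>V\<close> of \<open>f a\<close>, the ray from \<open>a\<close> in direction
  \<open>d\<close> starts inside \<open>f -` V\<close>.\<close>

lemma tauQ_continuous_iff_radial_limits: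
  "tauQ_continuous f \<longleftrightarrow>
     (\<forall>a d. d \<noteq> 0 \<longrightarrow> ((\<lambda>q. f (a + q * d)) \<longlongrightarrow> f a) rat_at_right_0)"
proof -
  have "tauQ_continuous f \<longleftrightarrow> (\<forall>V. open V \<longrightarrow> tauQ_open (f -` V))"
    by (simp add: tauQ_continuous_def continuous_map vimage_def)
  then show ?thesis
    unfolding tauQ_open_iff_eventually tendsto_def by auto
qed

lemma rat_line_diff:
  assumes "a \<in> rat_line x y" "b \<in> rat_line x y"
  obtains q where "q \<in> \<rat>" "b = a + q * (x - y)"
proof -
  obtain r s where "r \<in> \<rat>" "a = r * x + (1 - r) * y" "s \<in> \<rat>" "b = s * x + (1 - s) * y"
    using assms by (auto simp: rat_line_def)
  then have "s - r \<in> \<rat>" "b = a + (s - r) * (x - y)"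
    by (auto simp: algebra_simps)
  then show thesis
    by (rule that)
qed

lemma continuous_on_rat_line_if_radial_limits:
  assumes lim: "\<And>a d. d \<noteq> 0 \<Longrightarrow> ((\<lambda>q. f (a + q * d)) \<longlongrightarrow> f a) rat_at_right_0"
    and "x \<noteq> y"
  shows "continuous_on (rat_line x y) f"
  unfolding continuous_on_def
proof (intro ballI topological_tendstoI)
  fix a V
  assume a: "a \<in> rat_line x y" and V: "open V" "f a \<in> V"
  have "\<forall>\<^sub>F q in rat_at_right_0. f (a + q * d) \<in> V" if "d \<noteq> 0" for d
    using topological_tendstoD[OF lim[OF that] V] .
  from this[of "x - y"] this[of "y - x"] \<open>x \<noteq> y\<close>
  have "\<forall>\<^sub>F q in rat_at_right_0. f (a + q * (x - y)) \<in> V \<and> f (a + q * (y - x)) \<in> V"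
    by (simp add: eventually_conj)
  then obtain \<epsilon> where "\<epsilon> > 0"
    and \<epsilon>: "\<And>q. q \<in> \<rat> \<Longrightarrow> 0 < q \<Longrightarrow> q < \<epsilon> \<Longrightarrow> f (a + q * (x - y)) \<in> V \<and> f (a + q * (y - x)) \<in> V"
    by (auto simp: eventually_rat_at_right_0)
  have "f b \<in> V" if b: "b \<in> rat_line x y" "b \<noteq> a" "dist b a < \<epsilon> * \<bar>x - y\<bar>" for b
  proof -
    obtain q where q: "q \<in> \<rat>" "b = a + q * (x - y)"
      using rat_line_diff a b(1) .
    have "q \<noteq> 0" "\<bar>q\<bar> < \<epsilon>"
      using b q \<open>x \<noteq> y\<close> by (auto simp: dist_real_def abs_mult)
    have b': "b = a + (- q) * (y - x)"
      using q(2) by (simp add: algebra_simps)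
    \<comment> \<open>The sign of \<open>q\<close> decides on which of the two rays from \<open>a\<close> the point \<open>b\<close> lies.\<close>
    from \<open>q \<noteq> 0\<close> \<open>\<bar>q\<bar> < \<epsilon>\<close> consider "0 < q" "q < \<epsilon>" | "0 < - q" "- q < \<epsilon>"
      by linarith
    then show ?thesis
    proof cases
      case 1
      then show ?thesis using \<epsilon>[of q] q by metis
    next
      case 2
      then show ?thesis using \<epsilon>[of "- q"] q(1) b' by (metis Rats_minus_iff)
    qed
  qed
  moreover have "\<epsilon> * \<bar>x - y\<bar> > 0"
    using \<open>\<epsilon> > 0\<close> \<open>x \<noteq> y\<close> by simp
  ultimately show "\<forall>\<^sub>F b in at a within rat_line x y. f b \<in> V"
    unfolding eventually_at by blast
qed

lemma rat_segment_subset_rat_line: "rat_segment x y \<subseteq> rat_line x y"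
  by (auto simp: rat_segment_def rat_line_def)

lemma rat_segment_commute: "rat_segment x y = rat_segment y x"
proof -
  have "rat_segment x y \<subseteq> rat_segment y x" for x y
  proof
    fix z assume "z \<in> rat_segment x y"
    then obtain q where "q \<in> \<rat> \<inter> {0..1}" "z = q * x + (1 - q) * y"
      by (auto simp: rat_segment_def)
    then show "z \<in> rat_segment y x"
      unfolding rat_segment_def by (intro CollectI exI[of _ "1 - q"]) auto
  qed
  then show ?thesis by blast
qed

lemma radial_point_in_rat_segment:
  assumes "q \<in> \<rat>" "0 \<le> q" "q \<le> 1"
  shows "a + q * d \<in> rat_segment (a + d) a"
  unfolding rat_segment_def using assms
  by (intro CollectI exI[of _ q]) (auto simp: algebra_simps)

lemma radial_limit_if_continuous_on_rat_segment:
  assumes cont: "continuous_on (rat_segment (a + d) a) f" and "d \<noteq> 0"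
  shows "((\<lambda>q. f (a + q * d)) \<longlongrightarrow> f a) rat_at_right_0"
proof -
  have "a \<in> rat_segment (a + d) a"
    using radial_point_in_rat_segment[of 0 a d] by simp
  then have "(f \<longlongrightarrow> f a) (at a within rat_segment (a + d) a)"
    using cont by (simp add: continuous_on_def)
  moreover have "filterlim (\<lambda>q. a + q * d) (at a within rat_segment (a + d) a) rat_at_right_0"
    unfolding filterlim_at
  proof
    show "\<forall>\<^sub>F q in rat_at_right_0. a + q * d \<in> rat_segment (a + d) a \<and> a + q * d \<noteq> a"
      unfolding eventually_rat_at_right_0 using \<open>d \<noteq> 0\<close>
      by (intro exI[of _ 1]) (auto intro!: radial_point_in_rat_segment)
    show "((\<lambda>q. a + q * d) \<longlongrightarrow> a) rat_at_right_0"
      by (rule tendsto_eq_intros refl | simp)+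
  qed
  ultimately show ?thesis
    by (rule filterlim_compose)
qed

theorem theorem8p1:
  fixes f :: "real \<Rightarrow> real"
  shows "(tauQ_continuous f \<longleftrightarrow> (\<forall>x y. x < y \<longrightarrow> continuous_on (rat_line x y) f)) \<and>
         ((\<forall>x y. x < y \<longrightarrow> continuous_on (rat_line x y) f) \<longleftrightarrow>
          (\<forall>x y. x < y \<longrightarrow> continuous_on (rat_segment x y) f))"
    (is "(?tau \<longleftrightarrow> ?line) \<and> (?line \<longleftrightarrow> ?segment)")
proof -
  have "?line" if ?tau
    using that unfolding tauQ_continuous_iff_radial_limits
    by (auto intro!: continuous_on_rat_line_if_radial_limits)
  moreover have "?segment" if ?line
    using that continuous_on_subset rat_segment_subset_rat_line by blast
  moreover have "?tau" if segment: ?segment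
    unfolding tauQ_continuous_iff_radial_limits
  proof (intro allI impI)
    fix a d :: real
    assume "d \<noteq> 0"
    \<comment> \<open>For \<open>d > 0\<close> the end points come in the wrong order, hence the swap.\<close>
    then consider "a < a + d" | "a + d < a"
      by force
    then have "continuous_on (rat_segment (a + d) a) f"
      using segment rat_segment_commute[of "a + d" a] by cases metis+
    then show "((\<lambda>q. f (a + q * d)) \<longlongrightarrow> f a) rat_at_right_0"
      using \<open>d \<noteq> 0\<close> by (rule radial_limit_if_continuous_on_rat_segment)
  qed
  ultimately show ?thesis by blast
qed

end
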